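(* Let $0\le\alpha<1$. Let $f=h+\overline{g}$ be harmonic in $\mathbb{D}$, where $h(z)=z+\sum_{n=2}^{\infty}a_nz^n$ and $g(z)=\sum_{n=2}^{\infty}b_nz^n$, and suppose that for all $n\ge 2$ $$|a_n|\le \tfrac16(2n+1)(n+1),\qquad |b_n|\le \tfrac16(2n-1)(n-1),\qquad \big||a_n|-|b_n|\big|\le n .$$ Then for $D_f^{\epsilon}=zf_z-\epsilon\,\overline{z}f_{\overline{z}}$ ($|\epsilon|=1$): (1) the radius of fully starlikeness of order $\alpha$ is $r_s(\alpha)$, where $r_s(\alpha)$ is the unique root in the interval $(0,1)$ of the equation $p_\alpha(r)=0$, with $$p_{\alpha}(r)=1-\alpha -(17-9 \alpha) r+(13-21 \alpha ) r^2-21(1- \alpha ) r^3+10(1-\alpha ) r^4-2(1- \alpha) r^5;$$ (2) the radius of fully starlikeness is $r_u\approx 0.0614313$, where $r_u$ is the unique root in the interval $(0,1)$ of the equation $$1 -17 r+13 r^2-21 r^3+10 r^4-2 r^5= 0.$$ All the results are sharp.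
   Context: $\mathbb{D}=\{z\in\mathbb{C}:|z|<1\}$. $\mathcal{H}$ is the class of complex-valued harmonic functions $f=h+\overline g$ on $\mathbb{D}$ with $h,g$ analytic in $\mathbb{D}$, $h(0)=g(0)=0$, $h'(0)=1$. $\mathcal{S}_H$ is the class of univalent sense-preserving $f\in\mathcal{H}$ (sense-preserving: $|g'(z)|<|h'(z)|$ in $\mathbb{D}$). For $f=h+\overline g$ and $|\epsilon|=1$, $D_f^{\epsilon}(z)=zf_z-\epsilon\,\overline z f_{\overline z}=zh'(z)-\epsilon\,\overline{zg'(z)}$. For $0\le\alpha<1$, a function $F\in\mathcal{S}_H$ is fully starlike of order $\alpha$ (in $\mathbb{D}$) if it maps every circle $|z|=r<1$ in a one-to-one manner onto a curve satisfying $\frac{\partial}{\partial\theta}\arg F(re^{i\theta})>\alpha$ for $0\le\theta<2\pi$, $0<r<1$; "fully starlike" means fully starlike of order $0$. For $r\in(0,1)$, $F$ has such a property in $|z|<r$ if $F_r(z)=r^{-1}F(rz)$ has it in $\mathbb{D}$. The radius of a property of $D_f^\epsilon$ is the number $\rho$ such that $D_f^\epsilon$ has the property in $|z|<\rho$ for every $f$ satisfying the hypotheses. "Sharp" means that $\rho$ cannot be replaced by a larger number with the conclusion still holding for all data allowed by the hypotheses. *)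

theory Defs
  imports "HOL-Complex_Analysis.Complex_Analysis"
begin

abbreviation unit_disk :: "complex set" (\<open>\<bbbD>\<close>)
  where "\<bbbD> \<equiv> ball 0 1"

text \<open>Functions on the disk are total functions \<open>complex \<Rightarrow> complex\<close>; only their values
  on \<open>\<bbbD>\<close> matter below.\<close>

definition class_SH :: "(complex \<Rightarrow> complex) set" where
  "class_SH = {F. \<exists>h g.
      h holomorphic_on \<bbbD> \<and> g holomorphic_on \<bbbD> \<and>
      h 0 = 0 \<and> g 0 = 0 \<and> deriv h 0 = 1 \<and>
      (\<forall>z\<in>\<bbbD>. F z = h z + cnj (g z)) \<and>
      (\<forall>z\<in>\<bbbD>. cmod (deriv g z) < cmod (deriv h z)) \<and>
      inj_on F \<bbbD>}"

text \<open>Here \<open>\<phi>\<close> is a branch of \<open>\<theta> \<mapsto> arg F(r e\<^sup>i\<^sup>\<theta>)\<close>. It is required on all of \<open>\<real>\<close>, so that its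
  derivative at \<open>\<theta> = 0\<close> is two-sided. Since \<open>F\<close> is injective with \<open>F 0 = 0\<close>, the curve
  avoids the origin and its argument is defined everywhere.\<close>

definition fully_starlike_of_order :: "real \<Rightarrow> (complex \<Rightarrow> complex) \<Rightarrow> bool" where
  "fully_starlike_of_order \<alpha> F \<longleftrightarrow> F \<in> class_SH \<and>
     (\<forall>r\<in>{0<..<1}. inj_on F (sphere 0 r) \<and>
        (\<exists>\<phi>. (\<forall>\<theta>. F (of_real r * cis \<theta>) = of_real (cmod (F (of_real r * cis \<theta>))) * cis (\<phi> \<theta>)) \<and>
             (\<forall>\<theta>\<in>{0..<2*pi}. \<exists>d. (\<phi> has_real_derivative d) (at \<theta>) \<and> d > \<alpha>)))"

definition fully_starlike :: "(complex \<Rightarrow> complex) \<Rightarrow> bool" where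
  "fully_starlike = fully_starlike_of_order 0"

definition dilate :: "real \<Rightarrow> (complex \<Rightarrow> complex) \<Rightarrow> complex \<Rightarrow> complex" where
  "dilate r F = (\<lambda>z. F (of_real r * z) / of_real r)"

text \<open>The Wirtinger derivatives \<open>f\<^sub>z = (f\<^sub>x - i f\<^sub>y)/2\<close> and \<open>f\<^sub>z\<^sub>b\<^sub>a\<^sub>r = (f\<^sub>x + i f\<^sub>y)/2\<close>.\<close>

definition wirtinger :: "(complex \<Rightarrow> complex) \<Rightarrow> complex \<Rightarrow> complex" where
  "wirtinger f z =
     (frechet_derivative f (at z) 1 - \<i> * frechet_derivative f (at z) \<i>) / 2"

definition wirtinger_bar :: "(complex \<Rightarrow> complex) \<Rightarrow> complex \<Rightarrow> complex" where
  "wirtinger_bar f z =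
     (frechet_derivative f (at z) 1 + \<i> * frechet_derivative f (at z) \<i>) / 2"

definition D_op :: "complex \<Rightarrow> (complex \<Rightarrow> complex) \<Rightarrow> complex \<Rightarrow> complex" where
  "D_op \<epsilon> f z = z * wirtinger f z - \<epsilon> * cnj z * wirtinger_bar f z"

lemma D_op_harmonic:
  assumes hol: "h holomorphic_on \<bbbD>" "g holomorphic_on \<bbbD>"
    and f: "\<And>w. w \<in> \<bbbD> \<Longrightarrow> f w = h w + cnj (g w)" and z: "z \<in> \<bbbD>"
  shows "D_op \<epsilon> f z = z * deriv h z - \<epsilon> * cnj (z * deriv g z)"
proof -
  have h: "(h has_derivative (\<lambda>w. deriv h z * w)) (at z)"
    and g: "(g has_derivative (\<lambda>w. deriv g z * w)) (at z)"
    using hol z by (auto intro!: has_field_derivative_imp_has_derivative holomorphic_derivI)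
  have "((\<lambda>w. h w + cnj (g w)) has_derivative (\<lambda>w. deriv h z * w + cnj (deriv g z * w))) (at z)"
    by (intro derivative_intros h g)
  then have "(f has_derivative (\<lambda>w. deriv h z * w + cnj (deriv g z * w))) (at z)"
    by (rule has_derivative_transform_within_open[of _ _ _ _ \<bbbD>]) (use f z in auto)
  from frechet_derivative_at[OF this, symmetric] show ?thesis
    by (simp add: D_op_def wirtinger_def wirtinger_bar_def algebra_simps)
qed

definition admissible :: "(complex \<Rightarrow> complex) set" where
  "admissible = {f. \<exists>h g a b.
      (\<forall>z\<in>\<bbbD>. f z = h z + cnj (g z)) \<and>
      (\<forall>z\<in>\<bbbD>. (\<lambda>n. a n * z ^ n) sums h z) \<and> a 0 = 0 \<and> a 1 = 1 \<and>
      (\<forall>z\<in>\<bbbD>. (\<lambda>n. b n * z ^ n) sums g z) \<and> b 0 = 0 \<and> b 1 = 0 \<and>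
      (\<forall>n\<ge>2. cmod (a n) \<le> (2 * real n + 1) * (real n + 1) / 6 \<and>
             cmod (b n) \<le> (2 * real n - 1) * (real n - 1) / 6 \<and>
             \<bar>cmod (a n) - cmod (b n)\<bar> \<le> real n)}"

definition is_sharp_radius ::
  "((complex \<Rightarrow> complex) \<Rightarrow> bool) \<Rightarrow> (complex \<Rightarrow> complex) set \<Rightarrow> real \<Rightarrow> bool" where
  "is_sharp_radius P \<F> \<rho> \<longleftrightarrow> 0 < \<rho> \<and> \<rho> \<le> 1 \<and>
     (\<forall>F\<in>\<F>. P (dilate \<rho> F)) \<and>
     (\<forall>\<rho>'. \<rho> < \<rho>' \<and> \<rho>' \<le> 1 \<longrightarrow> \<not> (\<forall>F\<in>\<F>. P (dilate \<rho>' F)))"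

definition p_poly :: "real \<Rightarrow> real \<Rightarrow> real" where
  "p_poly \<alpha> r = 1 - \<alpha> - (17 - 9 * \<alpha>) * r + (13 - 21 * \<alpha>) * r^2
     - 21 * (1 - \<alpha>) * r^3 + 10 * (1 - \<alpha>) * r^4 - 2 * (1 - \<alpha>) * r^5"

end

theory Submission
  imports Defs
begin

text \<open>
Write \<open>f = h + cnj g\<close> with coefficients \<open>a n\<close> and \<open>b n\<close>. Then \<open>D_op \<epsilon> f\<close> is harmonic with coefficients
\<open>n * a n\<close> and, up to a unimodular factor, \<open>n * b n\<close>. For a map \<open>F z = z + \<Sum>A n z^n + cnj (\<Sum>B n z^n)\<close>
with sums from \<open>n = 2\<close>, the condition
\<open>\<Sum>(n - \<alpha>) * cmod (A n) + (n + \<alpha>) * cmod (B n) \<le> 1 - \<alpha>\<close> implies full starlikeness of order \<open>\<alpha>\<close>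
(\<open>fully_starlike_coefficient_criterion\<close>): it makes \<open>F\<close> a perturbation of the identity too small to
destroy univalence, orientation, or the lower bound on the angular derivative of the argument.

For the dilation of \<open>D_op \<epsilon> f\<close> by \<open>r\<close>, the coefficient bounds turn this condition into an inequality
for the power series with coefficients \<open>(2 n^4 + n^2) / 3 - \<alpha> n^2\<close>. Its closed form, the function
\<open>majorant \<alpha> r\<close>, is a sum of two increasing functions, the condition reads
\<open>majorant \<alpha> r \<le> 2 (1 - \<alpha>)\<close>, and multiplying by \<open>(1 - r)^5\<close> gives \<open>p_poly \<alpha> r \<ge> 0\<close>
(\<open>p_poly_eq_majorant\<close>). Monotonicity of the majorant is why the polynomial changes sign exactly
once in the unit interval (\<open>p_poly_unique_sign_change\<close>).

The radius is sharp because one admissible function has extremal coefficients whose phases align all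
terms on the positive real axis (\<open>extremal_admissible\<close>). There the angular derivative of the argument
equals \<open>\<alpha>\<close> at the root and is smaller than \<open>\<alpha>\<close> just beyond it (\<open>starlike_radius_cannot_grow\<close>). Full
starlikeness is the case \<open>\<alpha> = 0\<close>, and the numerical value follows from the signs of the polynomial
at two rational points.
\<close>

section \<open>Power series\<close>

lemma sums_power_series_derivative:
  fixes c :: "nat \<Rightarrow> 'a::{real_normed_field,banach}"
  assumes f: "\<And>x. norm x < 1 \<Longrightarrow> (\<lambda>n. c n * x ^ n) sums f x"
    and x: "norm x < 1"
  shows "\<exists>D. (f has_field_derivative D) (at x) \<and> (\<lambda>n. of_nat n * c n * x ^ (n - 1)) sums D"
proof -
  let ?D = "\<Sum>n. diffs c n * x ^ n"
  have sm: "summable (\<lambda>n. c n * y ^ n)" if "norm y < 1" for y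
    using f[OF that] by (rule sums_summable)
  have "((\<lambda>x. \<Sum>n. c n * x ^ n) has_field_derivative ?D) (at x)"
    by (rule termdiffs_strong'[OF sm x])
  then have "(f has_field_derivative ?D) (at x)"
    by (rule has_field_derivative_transform_within_open[where S = "ball 0 1"])
       (use x f in \<open>auto simp: sums_iff\<close>)
  moreover have "summable (\<lambda>n. diffs c n * x ^ n)"
    by (rule termdiff_converges[OF x sm])
  then have "(\<lambda>n. of_nat n * c n * x ^ (n - 1)) sums ?D"
    using diffs_equiv[of c x] by simp
  ultimately show ?thesis by blast
qed

text \<open>The operator \<open>x d/dx\<close> multiplies the \<open>n\<close>-th coefficient by \<open>n\<close> and keeps the exponent, so
  it can be iterated without shifting indices.\<close>
lemma sums_euler_derivative:
  fixes c :: "nat \<Rightarrow> 'a::{real_normed_field,banach}"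
  assumes f: "\<And>x. norm x < 1 \<Longrightarrow> (\<lambda>n. c n * x ^ n) sums f x"
    and x: "norm x < 1" and D: "(f has_field_derivative D) (at x)"
  shows "(\<lambda>n. of_nat n * c n * x ^ n) sums (x * D)"
proof -
  have "(\<lambda>n. of_nat n * c n * x ^ (n - 1)) sums D"
    using sums_power_series_derivative[of c f, OF f x] DERIV_unique[OF D] by metis
  then have "(\<lambda>n. x * (of_nat n * c n * x ^ (n - 1))) sums (x * D)"
    by (rule sums_mult)
  moreover have "x * (of_nat n * c n * x ^ (n - 1)) = of_nat n * c n * x ^ n" for n
    by (cases n) auto
  ultimately show ?thesis by (simp only:)
qed

lemma power_series_holomorphic_disk:
  assumes "\<And>z. z \<in> \<bbbD> \<Longrightarrow> (\<lambda>n. c n * z ^ n) sums f z"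
  shows "f holomorphic_on \<bbbD>"
proof (rule holomorphic_onI)
  fix z assume "z \<in> \<bbbD>"
  then have "\<exists>D. (f has_field_derivative D) (at z)"
    using sums_power_series_derivative[of c f z] assms by auto
  then show "f field_differentiable (at z within \<bbbD>)"
    by (auto simp: field_differentiable_def intro: has_field_derivative_at_within)
qed

text \<open>Every estimate of the harmonic map bounds the analytic and the co-analytic part together by
  one weight series; \<open>c\<close> carries the dependence on the points of the disk.\<close>
lemma norm_suminf_pair_le:
  fixes x y :: "nat \<Rightarrow> 'a::banach"
  assumes le: "\<And>n. norm (x n) + norm (y n) \<le> c * W n" and W: "summable W"
  shows "summable x" "summable y" "norm (suminf x) + norm (suminf y) \<le> c * suminf W"
proof -
  have cW: "summable (\<lambda>n. c * W n)" by (intro summable_mult W)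
  have "norm (x n) \<le> c * W n" "norm (y n) \<le> c * W n" for n
    using le[of n] norm_ge_zero[of "x n"] norm_ge_zero[of "y n"] by linarith+
  then have x: "summable (\<lambda>n. norm (x n))" and y: "summable (\<lambda>n. norm (y n))"
    by (auto intro!: summable_comparison_test'[OF cW])
  then show "summable x" "summable y" by (auto intro: summable_norm_cancel)
  have "norm (suminf x) + norm (suminf y) \<le> (\<Sum>n. norm (x n)) + (\<Sum>n. norm (y n))"
    by (intro add_mono summable_norm x y)
  also have "\<dots> = (\<Sum>n. norm (x n) + norm (y n))"
    by (rule suminf_add[OF x y])
  also have "\<dots> \<le> (\<Sum>n. c * W n)"
    by (intro suminf_le le summable_add x y cW)
  finally show "norm (suminf x) + norm (suminf y) \<le> c * suminf W"
    by (simp add: suminf_mult[OF W])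
qed

section \<open>Harmonic maps along circles\<close>

text \<open>On a circle, \<open>d/d\<theta>\<close> acts as \<open>\<i> z d/dz\<close> on holomorphic functions; conjugating the
  co-analytic part flips the sign of \<open>\<i>\<close>, hence the minus sign.\<close>
lemma harmonic_circle_derivative:
  assumes h: "(h has_field_derivative h') (at (of_real r * cis \<theta>))"
    and g: "(g has_field_derivative g') (at (of_real r * cis \<theta>))"
  shows "((\<lambda>\<theta>. h (of_real r * cis \<theta>) + cnj (g (of_real r * cis \<theta>)))
    has_vector_derivative
      \<i> * (of_real r * cis \<theta> * h' - cnj (of_real r * cis \<theta> * g'))) (at \<theta>)"
proof -
  let ?z = "of_real r * cis \<theta>"
  have z: "((\<lambda>\<theta>. of_real r * cis \<theta>) has_vector_derivative (\<i> * ?z)) (at \<theta>)"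
    by (auto intro!: derivative_eq_intros simp: has_vector_derivative_def scaleR_conv_of_real mult_ac)
  have "((h \<circ> (\<lambda>\<theta>. of_real r * cis \<theta>)) has_vector_derivative (\<i> * ?z * h')) (at \<theta>)"
    by (rule field_vector_diff_chain_at[OF z h])
  moreover have "((g \<circ> (\<lambda>\<theta>. of_real r * cis \<theta>)) has_vector_derivative (\<i> * ?z * g')) (at \<theta>)"
    by (rule field_vector_diff_chain_at[OF z g])
  ultimately have "((\<lambda>\<theta>. h (of_real r * cis \<theta>) + cnj (g (of_real r * cis \<theta>)))
      has_vector_derivative (\<i> * ?z * h' + cnj (\<i> * ?z * g'))) (at \<theta>)"
    by (intro has_vector_derivative_add has_vector_derivative_cnj) (auto simp: o_def)
  then show ?thesis by (simp add: algebra_simps)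
qed

text \<open>Logarithmic differentiation of \<open>P = cmod P * cis \<phi>\<close> gives
  \<open>P'/P = (cmod P)'/cmod P + \<i> \<phi>'\<close>. All differentiable branches therefore share one derivative, and
  computing it once refutes every candidate branch for a map that is not starlike.\<close>
lemma argument_branch_derivative:
  assumes P: "(P has_vector_derivative P') (at \<theta>)" and nz: "P \<theta> \<noteq> 0"
    and \<phi>: "(\<phi> has_real_derivative d) (at \<theta>)"
    and branch: "\<And>t. P t = of_real (cmod (P t)) * cis (\<phi> t)"
  shows "d = Im (P' / P \<theta>)"
proof -
  have D: "((\<lambda>t. cmod (P t)) has_derivative (\<lambda>y. inner (sgn (P \<theta>)) (y *\<^sub>R P'))) (at \<theta>)"
    using has_derivative_compose[OF P[unfolded has_vector_derivative_def] has_derivative_norm[OF nz]]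
    by (simp add: inner_commute)
  then obtain m where m: "((\<lambda>t. cmod (P t)) has_vector_derivative m) (at \<theta>)"
    by (intro that[of "inner (sgn (P \<theta>)) P'"])
       (simp only: has_vector_derivative_def inner_scaleR_right real_scaleR_def)
  have c: "((\<lambda>t. cis (\<phi> t)) has_vector_derivative (of_real d * (\<i> * cis (\<phi> \<theta>)))) (at \<theta>)"
    using \<phi>
    by (auto intro!: derivative_eq_intros
        simp: mult_ac has_vector_derivative_def scaleR_conv_of_real has_field_derivative_def)
  have "((\<lambda>t. of_real (cmod (P t)) * cis (\<phi> t)) has_vector_derivative
      (of_real (cmod (P \<theta>)) * (of_real d * (\<i> * cis (\<phi> \<theta>))) + of_real m * cis (\<phi> \<theta>))) (at \<theta>)"
    by (intro has_vector_derivative_mult c has_vector_derivative_of_real m[folded has_real_derivative_iff_has_vector_derivative])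
  then have "(P has_vector_derivative
      (of_real (cmod (P \<theta>)) * (of_real d * (\<i> * cis (\<phi> \<theta>))) + of_real m * cis (\<phi> \<theta>))) (at \<theta>)"
    using branch by simp
  from vector_derivative_unique_at[OF P this]
  have "P' / P \<theta> = (of_real (cmod (P \<theta>)) * (of_real d * (\<i> * cis (\<phi> \<theta>))) + of_real m * cis (\<phi> \<theta>))
      / (of_real (cmod (P \<theta>)) * cis (\<phi> \<theta>))"
    using branch[of \<theta>] by simp
  also have "\<dots> = \<i> * of_real d + of_real (m / cmod (P \<theta>))"
    using nz by (simp add: field_simps)
  finally show ?thesis by simp
qed

text \<open>If \<open>P \<theta> / cis \<theta>\<close> stays in the right half-plane, its principal logarithm is differentiable,
  and adding \<open>\<theta>\<close> to its imaginary part gives a global branch of the argument of \<open>P\<close>.\<close>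
lemma argument_branch_exists:
  assumes P: "\<And>\<theta>. (P has_vector_derivative P' \<theta>) (at \<theta>)"
    and pos: "\<And>\<theta>. Re (P \<theta> / cis \<theta>) > 0"
  shows "\<exists>\<phi>. (\<forall>\<theta>. P \<theta> = of_real (cmod (P \<theta>)) * cis (\<phi> \<theta>)) \<and>
    (\<forall>\<theta>. (\<phi> has_real_derivative Im (P' \<theta> / P \<theta>)) (at \<theta>))"
proof -
  define Q where "Q = (\<lambda>\<theta>. P \<theta> * cis (- \<theta>))"
  define \<phi> where "\<phi> = (\<lambda>\<theta>. \<theta> + Im (Ln (Q \<theta>)))"
  have Q: "Re (Q \<theta>) > 0" for \<theta>
    using pos[of \<theta>] by (simp add: Q_def divide_inverse)
  then have Q0: "Q \<theta> \<noteq> 0" for \<theta> by (metis less_irrefl zero_complex.sel(1))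
  have PQ: "P \<theta> = Q \<theta> * cis \<theta>" for \<theta> by (simp add: Q_def mult.assoc cis_mult)
  have "P \<theta> = of_real (cmod (P \<theta>)) * cis (\<phi> \<theta>)" for \<theta>
  proof -
    have "Q \<theta> = exp (Ln (Q \<theta>))" using Q0 by simp
    also have "\<dots> = of_real (cmod (Q \<theta>)) * cis (Im (Ln (Q \<theta>)))"
      using Q0 by (simp add: exp_eq_polar exp_of_real)
    finally have "P \<theta> = of_real (cmod (Q \<theta>)) * (cis \<theta> * cis (Im (Ln (Q \<theta>))))"
      by (metis PQ mult.assoc mult.commute)
    then show ?thesis by (simp add: \<phi>_def cis_mult PQ norm_mult)
  qed
  moreover have "(\<phi> has_real_derivative Im (P' \<theta> / P \<theta>)) (at \<theta>)" for \<theta>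
  proof -
    have c: "((\<lambda>\<theta>. cis (- \<theta>)) has_vector_derivative (- \<i> * cis (- \<theta>))) (at \<theta>)"
      by (auto intro!: derivative_eq_intros simp: mult_ac has_vector_derivative_def scaleR_conv_of_real)
    have Q': "(Q has_vector_derivative (P \<theta> * (- \<i> * cis (- \<theta>)) + P' \<theta> * cis (- \<theta>))) (at \<theta>)"
      unfolding Q_def by (intro has_vector_derivative_mult P c)
    have "Q \<theta> \<notin> \<real>\<^sub>\<le>\<^sub>0" using Q[of \<theta>] by (auto simp: complex_nonpos_Reals_iff)
    then have "(Ln has_field_derivative inverse (Q \<theta>)) (at (Q \<theta>))"
      by (rule has_field_derivative_Ln)
    from field_vector_diff_chain_at[OF Q' this]
    have L: "((\<lambda>\<theta>. Ln (Q \<theta>)) has_vector_derivative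
       ((P \<theta> * (- \<i> * cis (- \<theta>)) + P' \<theta> * cis (- \<theta>)) * inverse (Q \<theta>))) (at \<theta>)"
      by (simp add: o_def)
    have "P \<theta> \<noteq> 0" using Q0[of \<theta>] by (auto simp: Q_def)
    then have eq: "(P \<theta> * (- \<i> * cis (- \<theta>)) + P' \<theta> * cis (- \<theta>)) * inverse (Q \<theta>) = P' \<theta> / P \<theta> - \<i>"
      by (simp add: Q_def field_simps)
    have "((\<lambda>\<theta>. Im (Ln (Q \<theta>))) has_vector_derivative Im (P' \<theta> / P \<theta> - \<i>)) (at \<theta>)"
      using bounded_linear.has_vector_derivative[OF bounded_linear_Im L[unfolded eq]] .
    then have "((\<lambda>\<theta>. Im (Ln (Q \<theta>))) has_real_derivative Im (P' \<theta> / P \<theta> - \<i>)) (at \<theta>)"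
      by (simp add: has_real_derivative_iff_has_vector_derivative)
    from DERIV_add[OF DERIV_ident this] show ?thesis by (simp add: \<phi>_def)
  qed
  ultimately show ?thesis by blast
qed

section \<open>A coefficient criterion for full starlikeness\<close>

text \<open>For exponents from \<open>2\<close> on, a factor \<open>m\<close> can be kept besides the Lipschitz constant \<open>n\<close>. It
  makes the later inequalities strict inside the disk although the coefficient condition is not.\<close>
lemma norm_power_diff_le:
  fixes z w :: "'a::real_normed_field"
  assumes "norm z \<le> m" "norm w \<le> m" "m \<le> 1" "2 \<le> n"
  shows "norm (z ^ n - w ^ n) \<le> real n * (m * norm (z - w))"
proof -
  have m: "0 \<le> m" using assms(1) norm_ge_zero order_trans by blast
  have *: "norm (z ^ Suc k - w ^ Suc k) \<le> real (Suc k) * m ^ k * norm (z - w)" for k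
  proof (induction k)
    case (Suc k)
    have "z ^ Suc (Suc k) - w ^ Suc (Suc k) = z * (z ^ Suc k - w ^ Suc k) + (z - w) * w ^ Suc k"
      by (simp add: algebra_simps)
    also have "norm \<dots> \<le> norm z * norm (z ^ Suc k - w ^ Suc k) + norm (z - w) * norm w ^ Suc k"
      by (metis norm_triangle_ineq norm_mult norm_power)
    also have "\<dots> \<le> m * (real (Suc k) * m ^ k * norm (z - w)) + norm (z - w) * m ^ Suc k"
      using assms m Suc by (intro add_mono mult_mono power_mono order_refl) auto
    finally show ?case by (simp add: algebra_simps)
  qed simp
  define k where "k = n - 2"
  then have n: "n = Suc (Suc k)" using assms(4) by simp
  have "norm (z ^ n - w ^ n) \<le> real n * m ^ Suc k * norm (z - w)"
    using *[of "Suc k"] n by simp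
  also have "\<dots> \<le> real n * m * norm (z - w)"
    using m assms(3) power_decreasing[of 1 "Suc k" m] by (intro mult_right_mono mult_left_mono) auto
  finally show ?thesis by (simp add: mult_ac)
qed

text \<open>With \<open>u = N / D - \<alpha>\<close>, the hypothesis says that \<open>u\<close> is closer to \<open>1\<close> than to \<open>-1\<close>. In this
  form a lower bound on the real part of a quotient becomes a comparison of two norms, which can
  be estimated term by term.\<close>
lemma Re_divide_gt:
  assumes "cmod (N - of_real (1 + \<alpha>) * D) < cmod (N + of_real (1 - \<alpha>) * D)" and "D \<noteq> 0"
  shows "\<alpha> < Re (N / D)"
proof -
  define u where "u = N / D - of_real \<alpha>"
  have "N - of_real (1 + \<alpha>) * D = D * (u - 1)" "N + of_real (1 - \<alpha>) * D = D * (u + 1)"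
    using assms(2) by (auto simp: u_def field_simps)
  with assms have "cmod (u - 1) < cmod (u + 1)" by (simp add: norm_mult)
  then have "(cmod (u - 1))\<^sup>2 < (cmod (u + 1))\<^sup>2" by (intro power_strict_mono) auto
  then have "(Re u - 1)\<^sup>2 + (Im u)\<^sup>2 < (Re u + 1)\<^sup>2 + (Im u)\<^sup>2" by (simp add: cmod_power2)
  then have "0 < Re u" by (simp add: power2_eq_square algebra_simps)
  then show ?thesis by (simp add: u_def)
qed

text \<open>The weights add up as
  \<open>(n + 1 - \<alpha>) + (n - 1 - \<alpha>) = 2 (n - \<alpha>)\<close> and
  \<open>(n - 1 + \<alpha>) + (n + 1 + \<alpha>) = 2 (n + \<alpha>)\<close>. The left-hand sides are the weights of \<open>A n\<close> and \<open>B n\<close>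
  in the two norms compared by \<open>Re_divide_gt\<close> for \<open>N\<close> the angular derivative of \<open>F\<close> divided by
  \<open>\<i>\<close>. Their leading terms \<open>(2 - \<alpha>) z\<close> and \<open>- \<alpha> z\<close> leave a margin of \<open>2 (1 - \<alpha>) * cmod z\<close>, and
  the condition on the weighted sum says that the remaining terms do not use it up. For \<open>n \<ge> 1\<close>, \<open>n\<close> is
  at most \<open>(n - \<alpha>) / (1 - \<alpha>)\<close>, hence the same condition also yields univalence and orientation.\<close>
lemma fully_starlike_coefficient_criterion:
  fixes A B :: "nat \<Rightarrow> complex"
  assumes \<alpha>: "0 \<le> \<alpha>" "\<alpha> < 1"
    and F: "\<And>z. z \<in> \<bbbD> \<Longrightarrow> F z = z + (\<Sum>n. A n * z ^ n) + cnj (\<Sum>n. B n * z ^ n)"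
    and low: "\<And>n. n < 2 \<Longrightarrow> A n = 0 \<and> B n = 0"
    and W: "summable (\<lambda>n. (real n - \<alpha>) * cmod (A n) + (real n + \<alpha>) * cmod (B n))"
    and le: "(\<Sum>n. (real n - \<alpha>) * cmod (A n) + (real n + \<alpha>) * cmod (B n)) \<le> 1 - \<alpha>"
  shows "fully_starlike_of_order \<alpha> F"
proof -
  define W where "W = (\<lambda>n. (real n - \<alpha>) * cmod (A n) + (real n + \<alpha>) * cmod (B n))"
  have smW: "summable W" and sumW: "suminf W \<le> 1 - \<alpha>" using W le by (auto simp: W_def)
  have W': "(1 - \<alpha>) * (real n * cmod (A n) + real n * cmod (B n)) \<le> W n" for n
  proof (cases "n < 2")
    case False
    then have "0 \<le> \<alpha> * (real n - 1) * cmod (A n)" "0 \<le> \<alpha> * (real n + 1) * cmod (B n)"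
      using \<alpha> by (auto intro!: mult_nonneg_nonneg)
    then show ?thesis by (simp add: W_def algebra_simps)
  qed (use low in \<open>simp add: W_def\<close>)
  define U where "U = (\<lambda>n. real n * cmod (A n) + real n * cmod (B n))"
  have UW: "U n \<le> W n / (1 - \<alpha>)" for n
    using W'[of n] \<alpha> by (simp add: U_def field_simps)
  have U0: "U n \<ge> 0" for n by (simp add: U_def)
  have smU: "summable U"
    by (rule summable_comparison_test'[where g = "\<lambda>n. W n / (1 - \<alpha>)"])
       (use UW U0 in \<open>auto intro!: summable_divide smW\<close>)
  have "suminf U \<le> (\<Sum>n. W n / (1 - \<alpha>))"
    by (intro suminf_le UW smU summable_divide smW)
  also have "\<dots> = suminf W / (1 - \<alpha>)" by (rule suminf_divide[OF smW])
  also have "\<dots> \<le> 1" using sumW \<alpha> by simp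
  finally have sumU: "suminf U \<le> 1" .

  define u where "u = (\<lambda>z. \<Sum>n. A n * z ^ n)"
  define v where "v = (\<lambda>z. \<Sum>n. B n * z ^ n)"
  have AB: "cmod (A n * c) + cmod (B n * c) \<le> t * U n"
    if "n \<ge> 2 \<Longrightarrow> cmod c \<le> real n * t" for n c t
  proof (cases "n < 2")
    case False
    then show ?thesis
      using that mult_right_mono[of "cmod c" "real n * t" "cmod (A n)"]
        mult_right_mono[of "cmod c" "real n * t" "cmod (B n)"]
      by (simp add: U_def norm_mult algebra_simps)
  qed (use low in \<open>simp add: U_def\<close>)
  have sm: "summable (\<lambda>n. A n * z ^ n) \<and> summable (\<lambda>n. B n * z ^ n)" if "cmod z < 1" for z
  proof -
    have "cmod (A n * z ^ n) + cmod (B n * z ^ n) \<le> 1 * U n" for n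
      using that power_le_one[of "cmod z" n] by (intro AB) (auto simp: norm_power)
    from norm_suminf_pair_le[OF this smU] show ?thesis by blast
  qed
  then have usums: "(\<lambda>n. A n * z ^ n) sums u z" and vsums: "(\<lambda>n. B n * z ^ n) sums v z"
    if "cmod z < 1" for z
    using that by (auto simp: u_def v_def summable_sums)
  have uhol: "u holomorphic_on \<bbbD>" and vhol: "v holomorphic_on \<bbbD>"
    using usums vsums by (auto intro!: power_series_holomorphic_disk)
  have u': "(u has_field_derivative deriv u z) (at z)" and v': "(v has_field_derivative deriv v z) (at z)"
    if "cmod z < 1" for z
    using that by (auto intro!: holomorphic_derivI[OF uhol] holomorphic_derivI[OF vhol])
  have F: "F z = z + u z + cnj (v z)" if "cmod z < 1" for z
    using F that by (simp add: u_def v_def)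

  \<comment> \<open>\<open>F\<close> minus the identity is a contraction on each smaller disk. This gives injectivity and,
    with \<open>w = 0\<close>, keeps \<open>F z / z\<close> within distance \<open>cmod z\<close> of \<open>1\<close>.\<close>
  have contr: "cmod ((F z - F w) - (z - w)) \<le> max (cmod z) (cmod w) * cmod (z - w)"
    if z: "cmod z < 1" and w: "cmod w < 1" for z w
  proof -
    let ?m = "max (cmod z) (cmod w)"
    have bd: "cmod (A n * (z ^ n - w ^ n)) + cmod (B n * (z ^ n - w ^ n))
        \<le> (?m * cmod (z - w)) * U n" for n
      using z w by (intro AB norm_power_diff_le) auto
    have "(\<Sum>n. A n * (z ^ n - w ^ n)) = u z - u w" "(\<Sum>n. B n * (z ^ n - w ^ n)) = v z - v w"
      using sums_diff[OF usums[OF z] usums[OF w]] sums_diff[OF vsums[OF z] vsums[OF w]]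
      by (auto simp: sums_iff right_diff_distrib)
    with norm_suminf_pair_le(3)[OF bd smU]
    have "cmod (u z - u w) + cmod (v z - v w) \<le> (?m * cmod (z - w)) * suminf U" by simp
    also have "\<dots> \<le> (?m * cmod (z - w)) * 1"
      using sumU by (intro mult_left_mono) (auto simp: le_max_iff_disj)
    finally have "cmod (u z - u w) + cmod (cnj (v z - v w)) \<le> ?m * cmod (z - w)"
      by (simp only: complex_mod_cnj mult_1_right)
    moreover have "(F z - F w) - (z - w) = (u z - u w) + cnj (v z - v w)"
      using F z w by (simp add: algebra_simps)
    ultimately show ?thesis by (metis norm_triangle_ineq order_trans)
  qed
  have inj: "inj_on F \<bbbD>"
  proof (rule inj_onI, rule ccontr)
    fix z w assume zw: "z \<in> \<bbbD>" "w \<in> \<bbbD>" "F z = F w" "z \<noteq> w"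
    then have "cmod (z - w) \<le> max (cmod z) (cmod w) * cmod (z - w)"
      using contr[of z w] by (simp add: norm_minus_commute)
    moreover have "max (cmod z) (cmod w) * cmod (z - w) < 1 * cmod (z - w)"
      using zw by (intro mult_strict_right_mono) auto
    ultimately show False by simp
  qed

  have jac: "cmod (deriv v z) < cmod (1 + deriv u z)" if z: "cmod z < 1" for z
  proof -
    have bd: "cmod (A n * (of_nat n * z ^ (n - 1))) + cmod (B n * (of_nat n * z ^ (n - 1)))
        \<le> cmod z * U n" for n
      using z power_decreasing[of 1 "n - 1" "cmod z"]
      by (intro AB) (auto simp: norm_mult norm_power intro!: mult_left_mono)
    have "(\<lambda>n. of_nat n * A n * z ^ (n - 1)) sums deriv u z"
      using sums_power_series_derivative[of A u z] usums z DERIV_imp_deriv by blast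
    moreover have "(\<lambda>n. of_nat n * B n * z ^ (n - 1)) sums deriv v z"
      using sums_power_series_derivative[of B v z] vsums z DERIV_imp_deriv by blast
    ultimately have "(\<Sum>n. A n * (of_nat n * z ^ (n - 1))) = deriv u z"
      "(\<Sum>n. B n * (of_nat n * z ^ (n - 1))) = deriv v z"
      by (auto simp: sums_iff mult_ac)
    with norm_suminf_pair_le(3)[OF bd smU]
    have "cmod (deriv u z) + cmod (deriv v z) \<le> cmod z * suminf U" by simp
    also have "\<dots> \<le> cmod z * 1" using sumU by (intro mult_left_mono) auto
    finally have "cmod (deriv u z) + cmod (deriv v z) < 1" using z by simp
    moreover have "1 - cmod (deriv u z) \<le> cmod (1 + deriv u z)"
      using norm_diff_ineq[of 1 "deriv u z"] by simp
    ultimately show ?thesis by linarith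
  qed

  have F0: "F 0 = 0" "u 0 = 0" "v 0 = 0"
    using F[of 0] low[of 0] by (auto simp: u_def v_def)
  have du0: "deriv u 0 = 0"
  proof -
    obtain D where "(u has_field_derivative D) (at 0)" "(\<lambda>n. of_nat n * A n * 0 ^ (n - 1)) sums D"
      using sums_power_series_derivative[of A u 0] usums by auto
    moreover have "of_nat n * A n * 0 ^ (n - 1) = 0" for n
      using low[of n] by (cases "n < 2") auto
    ultimately have "D = 0" using sums_unique2[OF _ sums_zero, of D] by (simp only:)
    then show ?thesis using \<open>(u has_field_derivative D) (at 0)\<close> DERIV_imp_deriv by blast
  qed
  have SH: "F \<in> class_SH"
    unfolding class_SH_def mem_Collect_eq
  proof (rule exI[of _ "\<lambda>z. z + u z"], rule exI[of _ v], intro conjI ballI)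
    have d: "deriv (\<lambda>z. z + u z) z = 1 + deriv u z" if "cmod z < 1" for z
      using u'[OF that] by (intro DERIV_imp_deriv) (auto intro!: derivative_eq_intros)
    show "deriv (\<lambda>z. z + u z) 0 = 1" using d[of 0] du0 by simp
    show "cmod (deriv v z) < cmod (deriv (\<lambda>z. z + u z) z)" if "z \<in> \<bbbD>" for z
      using d[of z] jac[of z] that by simp
  qed (use F F0 inj uhol vhol in \<open>auto intro!: holomorphic_intros\<close>)

  \<comment> \<open>The first real part is the angular derivative of the argument of \<open>F\<close>.\<close>
  have star: "\<alpha> < Re ((z + z * deriv u z - cnj (z * deriv v z)) / F z) \<and> Re (F z / z) > 0"
    if z: "cmod z < 1" "z \<noteq> 0" for z
  proof
    define N where "N = z + z * deriv u z - cnj (z * deriv v z)"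
    have "cmod (F z - z) \<le> cmod z * cmod z"
      using contr[of z 0] z by (simp add: F0)
    moreover have "F z / z - 1 = (F z - z) / z" using z by (simp add: diff_divide_distrib)
    ultimately have "cmod (F z / z - 1) \<le> cmod z"
      using z by (simp add: norm_divide pos_divide_le_eq)
    then have "Re (1 - F z / z) < 1"
      using z complex_Re_le_cmod[of "1 - F z / z"] by (simp add: norm_minus_commute)
    then show pos: "Re (F z / z) > 0" by simp
    then have Fz: "F z \<noteq> 0" by auto
    have us: "(\<lambda>n. A n * z ^ n) sums u z" "(\<lambda>n. B n * z ^ n) sums v z"
      "(\<lambda>n. of_nat n * A n * z ^ n) sums (z * deriv u z)"
      "(\<lambda>n. of_nat n * B n * z ^ n) sums (z * deriv v z)"
      using usums vsums z u'[OF z(1)] v'[OF z(1)] by (auto intro!: sums_euler_derivative)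
    \<comment> \<open>\<open>W1\<close> and \<open>W2\<close> weigh the tails of \<open>N + (1 - \<alpha>) F z\<close> and \<open>N - (1 + \<alpha>) F z\<close>.\<close>
    define W1 where "W1 = (\<lambda>n. (real n + 1 - \<alpha>) * cmod (A n) + (real n - 1 + \<alpha>) * cmod (B n))"
    define W2 where "W2 = (\<lambda>n. (real n - 1 - \<alpha>) * cmod (A n) + (real n + 1 + \<alpha>) * cmod (B n))"
    have nonneg: "W1 n \<ge> 0 \<and> W2 n \<ge> 0" for n
      by (cases "n < 2") (use low \<alpha> in \<open>auto simp: W1_def W2_def\<close>)
    have W12: "W1 n + W2 n = 2 * W n" for n by (simp add: W1_def W2_def W_def algebra_simps)
    have "W1 n \<le> 2 * W n" "W2 n \<le> 2 * W n" for n using nonneg[of n] W12[of n] by auto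
    then have sm1: "summable W1" and sm2: "summable W2"
      using nonneg by (auto intro!: summable_comparison_test'[OF summable_mult[OF smW, of 2]])
    have sum12: "suminf W1 + suminf W2 \<le> 2 * (1 - \<alpha>)"
      using suminf_add[OF sm1 sm2] suminf_mult[OF smW, of 2] sumW by (simp add: W12)
    have zn: "cmod z ^ n \<le> (cmod z)\<^sup>2" if "\<not> n < 2" for n
      using z that by (intro power_decreasing) auto
    have b1: "cmod (of_real (real n + (1 - \<alpha>)) * (A n * z ^ n)) + cmod (of_real (real n + (- 1 + \<alpha>)) * (B n * z ^ n))
        \<le> (cmod z)\<^sup>2 * W1 n" for n
    proof (cases "n < 2")
      case False
      then have "cmod (of_real (real n + (1 - \<alpha>))) = real n + 1 - \<alpha>"
        "cmod (of_real (real n + (- 1 + \<alpha>))) = real n - 1 + \<alpha>" using \<alpha> by (auto simp del: of_real_add of_real_diff)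
      then have "cmod (of_real (real n + (1 - \<alpha>)) * (A n * z ^ n)) + cmod (of_real (real n + (- 1 + \<alpha>)) * (B n * z ^ n))
        = cmod z ^ n * W1 n" by (simp add: norm_mult norm_power W1_def algebra_simps del: of_real_add of_real_diff)
      then show ?thesis using mult_right_mono[OF zn[OF False]] nonneg[of n] by simp
    qed (use low in \<open>simp add: W1_def\<close>)
    have b2: "cmod (of_real (real n + (- 1 - \<alpha>)) * (A n * z ^ n)) + cmod (of_real (real n + (1 + \<alpha>)) * (B n * z ^ n))
        \<le> (cmod z)\<^sup>2 * W2 n" for n
    proof (cases "n < 2")
      case False
      then have "cmod (of_real (real n + (- 1 - \<alpha>))) = real n - 1 - \<alpha>"
        "cmod (of_real (real n + (1 + \<alpha>))) = real n + 1 + \<alpha>" using \<alpha> by (auto simp del: of_real_add of_real_diff)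
      then have "cmod (of_real (real n + (- 1 - \<alpha>)) * (A n * z ^ n)) + cmod (of_real (real n + (1 + \<alpha>)) * (B n * z ^ n))
        = cmod z ^ n * W2 n" by (simp add: norm_mult norm_power W2_def algebra_simps del: of_real_add of_real_diff)
      then show ?thesis using mult_right_mono[OF zn[OF False]] nonneg[of n] by simp
    qed (use low in \<open>simp add: W2_def\<close>)
    have comb: "(\<lambda>n. of_real (real n + c) * (A n * z ^ n)) sums (z * deriv u z + of_real c * u z)"
      "(\<lambda>n. of_real (real n + c) * (B n * z ^ n)) sums (z * deriv v z + of_real c * v z)" for c
      using sums_add[OF us(3) sums_mult[OF us(1), of "of_real c"]]
        sums_add[OF us(4) sums_mult[OF us(2), of "of_real c"]]
      by (simp_all add: algebra_simps)
    note n1 = norm_suminf_pair_le(3)[OF b1 sm1] and n2 = norm_suminf_pair_le(3)[OF b2 sm2]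
    define x1 y1 x2 y2 where "x1 = z * deriv u z + of_real (1 - \<alpha>) * u z"
      and "y1 = z * deriv v z + of_real (- 1 + \<alpha>) * v z"
      and "x2 = z * deriv u z + of_real (- 1 - \<alpha>) * u z"
      and "y2 = z * deriv v z + of_real (1 + \<alpha>) * v z"
    have "cmod x1 + cmod y1 \<le> (cmod z)\<^sup>2 * suminf W1"
      using n1 unfolding x1_def y1_def sums_unique[OF comb(1), symmetric] sums_unique[OF comb(2), symmetric] .
    moreover have "cmod x2 + cmod y2 \<le> (cmod z)\<^sup>2 * suminf W2"
      using n2 unfolding x2_def y2_def sums_unique[OF comb(1), symmetric] sums_unique[OF comb(2), symmetric] .
    moreover have "(cmod z)\<^sup>2 * suminf W1 + (cmod z)\<^sup>2 * suminf W2 \<le> (cmod z)\<^sup>2 * (2 * (1 - \<alpha>))"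
      using mult_left_mono[OF sum12, of "(cmod z)\<^sup>2"] by (simp add: algebra_simps)
    moreover have "(cmod z)\<^sup>2 * (2 * (1 - \<alpha>)) < cmod z * (2 * (1 - \<alpha>))"
      using z \<alpha> by (intro mult_strict_right_mono) (auto simp: power2_eq_square)
    ultimately have small: "cmod x1 + cmod y1 + (cmod x2 + cmod y2) < cmod z * (2 * (1 - \<alpha>))"
      by linarith
    have Np: "N + of_real (1 - \<alpha>) * F z = of_real (2 - \<alpha>) * z + (x1 - cnj y1)"
      using z F[of z] by (simp add: N_def x1_def y1_def algebra_simps)
    have Nm: "N - of_real (1 + \<alpha>) * F z = (x2 - cnj y2) - of_real \<alpha> * z"
      using z F[of z] by (simp add: N_def x2_def y2_def algebra_simps)
    have "cmod (N - of_real (1 + \<alpha>) * F z) \<le> cmod x2 + cmod y2 + \<alpha> * cmod z"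
      unfolding Nm using norm_triangle_ineq4[of "x2 - cnj y2" "of_real \<alpha> * z"] norm_triangle_ineq4[of x2 "cnj y2"] \<alpha>
      by (simp add: norm_mult)
    moreover have "(2 - \<alpha>) * cmod z - (cmod x1 + cmod y1) \<le> cmod (N + of_real (1 - \<alpha>) * F z)"
      unfolding Np using norm_diff_ineq[of "of_real (2 - \<alpha>) * z" "x1 - cnj y1"] norm_triangle_ineq4[of x1 "cnj y1"] \<alpha>
      by (simp add: norm_mult del: of_real_diff)
    ultimately have "cmod (N - of_real (1 + \<alpha>) * F z) < cmod (N + of_real (1 - \<alpha>) * F z)"
      using small by (simp add: algebra_simps)
    from Re_divide_gt[OF this Fz]
    show "\<alpha> < Re ((z + z * deriv u z - cnj (z * deriv v z)) / F z)" by (simp add: N_def)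
  qed

  have "\<exists>\<phi>. (\<forall>\<theta>. F (of_real r * cis \<theta>) = of_real (cmod (F (of_real r * cis \<theta>))) * cis (\<phi> \<theta>)) \<and>
             (\<forall>\<theta>\<in>{0..<2*pi}. \<exists>d. (\<phi> has_real_derivative d) (at \<theta>) \<and> d > \<alpha>)"
    if r: "0 < r" "r < 1" for r
  proof -
    have zr: "cmod (of_real r * cis \<theta>) < 1" "of_real r * cis \<theta> \<noteq> 0" for \<theta>
      using r by (auto simp: norm_mult)
    define P' where "P' = (\<lambda>\<theta>. \<i> * (of_real r * cis \<theta> * (1 + deriv u (of_real r * cis \<theta>))
        - cnj (of_real r * cis \<theta> * deriv v (of_real r * cis \<theta>))))"
    have "((\<lambda>\<theta>. F (of_real r * cis \<theta>)) has_vector_derivative P' \<theta>) (at \<theta>)" for \<theta>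
      unfolding F[OF zr(1)] P'_def
      by (rule harmonic_circle_derivative[where h = "\<lambda>z. z + u z"])
         (auto intro!: derivative_eq_intros u' v' zr)
    moreover have "Re (F (of_real r * cis \<theta>) / cis \<theta>) > 0" for \<theta>
    proof -
      have eq: "F (of_real r * cis \<theta>) / cis \<theta> = of_real r * (F (of_real r * cis \<theta>) / (of_real r * cis \<theta>))"
        using r by simp
      have "Re (of_real r * w) = r * Re w" for w by simp
      then show ?thesis
        unfolding eq using mult_pos_pos[OF r(1) conjunct2[OF star[OF zr[of \<theta>]]]] by (simp only:)
    qed
    ultimately obtain \<phi> where \<phi>: "\<forall>\<theta>. F (of_real r * cis \<theta>) = of_real (cmod (F (of_real r * cis \<theta>))) * cis (\<phi> \<theta>)"
      "\<forall>\<theta>. (\<phi> has_real_derivative Im (P' \<theta> / F (of_real r * cis \<theta>))) (at \<theta>)"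
      using argument_branch_exists[of "\<lambda>\<theta>. F (of_real r * cis \<theta>)" P'] by blast
    moreover have "\<alpha> < Im (P' \<theta> / F (of_real r * cis \<theta>))" for \<theta>
    proof -
      let ?z = "of_real r * cis \<theta>"
      have eq: "P' \<theta> / F ?z = \<i> * ((?z + ?z * deriv u ?z - cnj (?z * deriv v ?z)) / F ?z)"
        by (simp add: P'_def distrib_left)
      have "Im (\<i> * w) = Re w" for w by simp
      then show ?thesis
        unfolding eq using conjunct1[OF star[OF zr[of \<theta>]]] by (simp only:)
    qed
    ultimately show ?thesis by blast
  qed
  moreover have "inj_on F (sphere 0 r)" if "r < 1" for r
    using that by (intro inj_on_subset[OF inj]) auto
  ultimately show ?thesis using SH by (auto simp: fully_starlike_of_order_def)
qed

section \<open>The majorant series\<close>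

text \<open>Keeps every derivative over a single power of \<open>1 - x\<close>, so that iterating \<open>x d/dx\<close> from the
  geometric series produces the Eulerian polynomials as numerators.\<close>
lemma has_real_derivative_over_one_minus_power:
  assumes p: "(p has_real_derivative p') (at x)" and x: "x \<noteq> 1"
  shows "((\<lambda>x. p x / (1 - x) ^ k) has_real_derivative
    ((p' * (1 - x) + real k * p x) / (1 - x) ^ Suc k)) (at x)"
proof -
  have "((\<lambda>x. (1 - x) ^ k) has_real_derivative - (real k * (1 - x) ^ (k - 1))) (at x)"
    by (auto intro!: derivative_eq_intros)
  from DERIV_divide[OF p this]
  have "((\<lambda>x. p x / (1 - x) ^ k) has_real_derivative
    ((p' * (1 - x) ^ k - p x * - (real k * (1 - x) ^ (k - 1))) / ((1 - x) ^ k * (1 - x) ^ k))) (at x)"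
    using x by simp
  moreover have "(p' * (1 - x) ^ k - p x * - (real k * (1 - x) ^ (k - 1))) / ((1 - x) ^ k * (1 - x) ^ k)
     = (p' * (1 - x) + real k * p x) / (1 - x) ^ Suc k"
  proof (cases k)
    case (Suc j)
    have "p' * (1 - x) ^ k - p x * - (real k * (1 - x) ^ (k - 1))
      = (1 - x) ^ j * (p' * (1 - x) + real k * p x)"
      using Suc by (simp add: algebra_simps)
    moreover have "(1 - x) ^ k * (1 - x) ^ k = (1 - x) ^ j * (1 - x) ^ Suc k"
      using Suc by simp
    ultimately show ?thesis
      using x by (simp only: nonzero_mult_divide_mult_cancel_left power_eq_0_iff right_minus_eq) simp
  qed (use x in simp)
  ultimately show ?thesis by simp
qed

lemma sums_second_and_fourth_powers:
  fixes x :: real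
  assumes "\<bar>x\<bar> < 1"
  shows "(\<lambda>n. real n ^ 2 * x ^ n) sums (x * (1 + x) / (1 - x) ^ 3)"
    and "(\<lambda>n. real n ^ 4 * x ^ n) sums (x * (1 + 11 * x + 11 * x ^ 2 + x ^ 3) / (1 - x) ^ 5)"
proof -
  have 0: "(\<lambda>n. 1 * x ^ n) sums (1 / (1 - x) ^ 1)" if "norm x < 1" for x :: real
    using geometric_sums[OF that] by simp
  have 1: "(\<lambda>n. real n * x ^ n) sums (x / (1 - x) ^ 2)" if x: "norm x < 1" for x :: real
  proof -
    have "((\<lambda>x::real. 1 / (1 - x) ^ 1) has_real_derivative ((0 * (1 - x) + real 1 * 1) / (1 - x) ^ Suc 1)) (at x)"
      using x by (intro has_real_derivative_over_one_minus_power DERIV_const) auto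
    from sums_euler_derivative[OF 0 x this] show ?thesis by (simp add: numeral_2_eq_2)
  qed
  have 2: "(\<lambda>n. real n ^ 2 * x ^ n) sums ((x + x ^ 2) / (1 - x) ^ 3)" if x: "norm x < 1" for x :: real
  proof -
    have "((\<lambda>x::real. x / (1 - x) ^ 2) has_real_derivative ((1 * (1 - x) + real 2 * x) / (1 - x) ^ Suc 2)) (at x)"
      using x by (intro has_real_derivative_over_one_minus_power DERIV_ident) auto
    from sums_euler_derivative[OF 1 x this]
    show ?thesis by (simp add: numeral_eq_Suc algebra_simps)
  qed
  have 3: "(\<lambda>n. real n ^ 3 * x ^ n) sums ((x + 4 * x ^ 2 + x ^ 3) / (1 - x) ^ 4)" if x: "norm x < 1" for x :: real
  proof -
    have "((\<lambda>x::real. x + x ^ 2) has_real_derivative (1 + 2 * x)) (at x)"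
      by (auto intro!: derivative_eq_intros)
    then have "((\<lambda>x::real. (x + x ^ 2) / (1 - x) ^ 3) has_real_derivative
        (((1 + 2 * x) * (1 - x) + real 3 * (x + x ^ 2)) / (1 - x) ^ Suc 3)) (at x)"
      using x by (intro has_real_derivative_over_one_minus_power) auto
    from sums_euler_derivative[OF 2 x this]
    have "(\<lambda>n. real n * (real n)\<^sup>2 * x ^ n) sums
       (x * (((1 + 2 * x) * (1 - x) + real 3 * (x + x\<^sup>2)) / (1 - x) ^ Suc 3))" by simp
    moreover have E: "x * ((1 + 2 * x) * (1 - x) + real 3 * (x + x\<^sup>2)) = x + 4 * x ^ 2 + x ^ 3"
      by (simp add: algebra_simps power2_eq_square power3_eq_cube)
    moreover have "real n * (real n)\<^sup>2 = real n ^ 3" for n by (simp add: power2_eq_square power3_eq_cube)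
    moreover have "Suc 3 = 4" by simp
    ultimately show ?thesis by (simp only: times_divide_eq_right)
  qed
  have 4: "(\<lambda>n. real n ^ 4 * x ^ n) sums (x * (1 + 11 * x + 11 * x ^ 2 + x ^ 3) / (1 - x) ^ 5)"
    if x: "norm x < 1" for x :: real
  proof -
    have "((\<lambda>x::real. x + 4 * x ^ 2 + x ^ 3) has_real_derivative (1 + 8 * x + 3 * x ^ 2)) (at x)"
      by (auto intro!: derivative_eq_intros)
    then have "((\<lambda>x::real. (x + 4 * x ^ 2 + x ^ 3) / (1 - x) ^ 4) has_real_derivative
        (((1 + 8 * x + 3 * x ^ 2) * (1 - x) + real 4 * (x + 4 * x ^ 2 + x ^ 3)) / (1 - x) ^ Suc 4)) (at x)"
      using x by (intro has_real_derivative_over_one_minus_power) auto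
    from sums_euler_derivative[OF 3 x this]
    have "(\<lambda>n. real n * real n ^ 3 * x ^ n) sums
       (x * (((1 + 8 * x + 3 * x ^ 2) * (1 - x) + real 4 * (x + 4 * x ^ 2 + x ^ 3)) / (1 - x) ^ Suc 4))" by simp
    moreover have "(1 + 8 * x + 3 * x ^ 2) * (1 - x) + real 4 * (x + 4 * x ^ 2 + x ^ 3)
      = 1 + 11 * x + 11 * x ^ 2 + x ^ 3"
      by (simp add: algebra_simps power2_eq_square power3_eq_cube)
    moreover have "real n * real n ^ 3 = real n ^ 4" for n by (simp add: numeral_eq_Suc)
    moreover have "Suc 4 = 5" by simp
    ultimately show ?thesis by (simp only: times_divide_eq_right)
  qed
  show "(\<lambda>n. real n ^ 2 * x ^ n) sums (x * (1 + x) / (1 - x) ^ 3)"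
    using 2[of x] assms by (simp add: power2_eq_square distrib_left)
  show "(\<lambda>n. real n ^ 4 * x ^ n) sums (x * (1 + 11 * x + 11 * x ^ 2 + x ^ 3) / (1 - x) ^ 5)"
    using 4[of x] assms by simp
qed

text \<open>For \<open>n \<ge> 2\<close> this is the largest possible value of
  \<open>n * ((n - \<alpha>) * cmod (a n) + (n + \<alpha>) * cmod (b n))\<close> under the coefficient bounds; at \<open>n = 1\<close> it is
  \<open>1 - \<alpha>\<close>, the weight of the leading term \<open>z\<close>.\<close>
definition majorant_coeff :: "real \<Rightarrow> nat \<Rightarrow> real" where
  "majorant_coeff \<alpha> n = (2 * real n ^ 4 + real n ^ 2) / 3 - \<alpha> * real n ^ 2"

text \<open>The sum of \<open>majorant_coeff \<alpha> n * x ^ (n - 1)\<close> over \<open>n \<ge> 1\<close>, arranged so that both summands are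
  visibly increasing on \<open>[0, 1)\<close> for every \<open>\<alpha> < 1\<close>.\<close>
definition majorant :: "real \<Rightarrow> real \<Rightarrow> real" where
  "majorant \<alpha> x = (1 - \<alpha>) * (1 + x) / (1 - x) ^ 3 + 8 * x * (1 + x) / (1 - x) ^ 5"

lemma majorant_sums:
  assumes x: "\<bar>x\<bar> < 1"
  shows "(\<lambda>n. majorant_coeff \<alpha> n * x ^ n) sums (x * majorant \<alpha> x)"
proof -
  have "(\<lambda>n. 2 / 3 * (real n ^ 4 * x ^ n) + (1 / 3 - \<alpha>) * (real n ^ 2 * x ^ n)) sums
    (2 / 3 * (x * (1 + 11 * x + 11 * x ^ 2 + x ^ 3) / (1 - x) ^ 5) + (1 / 3 - \<alpha>) * (x * (1 + x) / (1 - x) ^ 3))"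
    by (intro sums_add sums_mult sums_second_and_fourth_powers x)
  moreover have "2 / 3 * (real n ^ 4 * x ^ n) + (1 / 3 - \<alpha>) * (real n ^ 2 * x ^ n) = majorant_coeff \<alpha> n * x ^ n" for n
    by (simp add: majorant_coeff_def field_simps)
  moreover have "2 / 3 * (x * (1 + 11 * x + 11 * x ^ 2 + x ^ 3) / (1 - x) ^ 5) + (1 / 3 - \<alpha>) * (x * (1 + x) / (1 - x) ^ 3)
    = x * majorant \<alpha> x"
  proof -
    define i where "i = 1 / (1 - x)"
    have i: "i * (1 - x) = 1" using x by (simp add: i_def)
    have "2 / 3 * (x * (1 + 11 * x + 11 * x ^ 2 + x ^ 3) * i ^ 5) + (1 / 3 - \<alpha>) * (x * (1 + x) * i ^ 3)
      = x * ((1 - \<alpha>) * (1 + x) * i ^ 3 + 8 * x * (1 + x) * i ^ 5)"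
    proof -
      have "i ^ 3 = i ^ 5 * (1 - x) ^ 2" using i by algebra
      then show ?thesis by (simp only:) (simp add: field_simps power2_eq_square power3_eq_cube)
    qed
    then show ?thesis by (simp add: majorant_def i_def power_divide)
  qed
  ultimately show ?thesis by simp
qed

text \<open>The polynomial is the coefficient condition with denominators cleared: the threshold is
  \<open>2 (1 - \<alpha>)\<close>, one half of which is taken by the term \<open>n = 1\<close> of the majorant.\<close>
lemma p_poly_eq_majorant:
  assumes "x \<noteq> 1"
  shows "p_poly \<alpha> x = (1 - x) ^ 5 * (2 * (1 - \<alpha>) - majorant \<alpha> x)"
proof -
  have h: "(1 - x) ^ 5 = (1 - x) ^ 2 * (1 - x) ^ 3" by (simp flip: power_add)
  have "(1 - x) ^ 5 * ((1 - \<alpha>) * (1 + x) / (1 - x) ^ 3) = (1 - \<alpha>) * (1 + x) * (1 - x) ^ 2"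
  proof -
    have "v * u * (c / u) = c * v" if "u \<noteq> 0" for u v c :: real using that by simp
    moreover have "(1 - x) ^ 3 \<noteq> 0" using assms by simp
    ultimately show ?thesis unfolding h by blast
  qed
  moreover have "(1 - x) ^ 5 * (8 * x * (1 + x) / (1 - x) ^ 5) = 8 * x * (1 + x)"
    using assms by simp
  ultimately have "(1 - x) ^ 5 * majorant \<alpha> x = (1 - \<alpha>) * (1 + x) * (1 - x) ^ 2 + 8 * x * (1 + x)"
    by (simp only: majorant_def distrib_left)
  then have "(1 - x) ^ 5 * (2 * (1 - \<alpha>) - majorant \<alpha> x)
    = 2 * (1 - \<alpha>) * (1 - x) ^ 5 - ((1 - \<alpha>) * (1 + x) * (1 - x) ^ 2 + 8 * x * (1 + x))"
    by (simp add: right_diff_distrib mult_ac)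
  also have "\<dots> = p_poly \<alpha> x" unfolding p_poly_def by algebra
  finally show ?thesis by simp
qed

lemma majorant_strict_mono:
  assumes "\<alpha> < 1" "0 \<le> x" "x < y" "y < 1"
  shows "majorant \<alpha> x < majorant \<alpha> y"
proof -
  have "(1 - \<alpha>) * (1 + x) / (1 - x) ^ 3 < (1 - \<alpha>) * (1 + y) / (1 - y) ^ 3"
    using assms by (intro frac_less2 mult_strict_left_mono power_strict_mono) (auto intro!: frac_less mult_strict_left_mono power_mono)
  moreover have "8 * x * (1 + x) / (1 - x) ^ 5 \<le> 8 * y * (1 + y) / (1 - y) ^ 5"
    using assms by (intro frac_le mult_mono power_mono) auto
  ultimately show ?thesis by (simp add: majorant_def)
qed

lemma p_poly_unique_sign_change:
  assumes \<alpha>: "\<alpha> < 1"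
  obtains r where "0 < r" "r < 1" "p_poly \<alpha> r = 0"
    "\<And>x. 0 \<le> x \<Longrightarrow> x < r \<Longrightarrow> 0 < p_poly \<alpha> x" "\<And>x. r < x \<Longrightarrow> x < 1 \<Longrightarrow> p_poly \<alpha> x < 0"
proof -
  have ends: "p_poly \<alpha> 0 > 0" "p_poly \<alpha> 1 < 0" using \<alpha> by (auto simp: p_poly_def)
  have "continuous_on {0..1} (p_poly \<alpha>)"
    unfolding p_poly_def[abs_def] by (intro continuous_intros)
  then obtain r where r: "0 \<le> r" "r \<le> 1" "p_poly \<alpha> r = 0"
    using IVT2'[of "p_poly \<alpha>" 1 0 0] ends by auto
  have r01: "0 < r" "r < 1" using r ends by (auto simp: less_le)
  then have Qr: "majorant \<alpha> r = 2 * (1 - \<alpha>)" using r(3) p_poly_eq_majorant[of r \<alpha>] by simp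
  show ?thesis
  proof (rule that[OF r01 r(3)])
    show "0 < p_poly \<alpha> x" if "0 \<le> x" "x < r" for x
      using majorant_strict_mono[OF \<alpha> that r01(2)] p_poly_eq_majorant[of x \<alpha>] that r01 Qr by simp
    show "p_poly \<alpha> x < 0" if "r < x" "x < 1" for x
      using majorant_strict_mono[OF \<alpha> less_imp_le[OF r01(1)] that] p_poly_eq_majorant[of x \<alpha>] that Qr
      by (simp add: mult_less_0_iff)
  qed
qed

section \<open>The radius\<close>

lemma sums_euler_disk:
  assumes h: "\<And>z. z \<in> \<bbbD> \<Longrightarrow> (\<lambda>n. a n * z ^ n) sums h z" and z: "z \<in> \<bbbD>"
  shows "(\<lambda>n. of_nat n * a n * z ^ n) sums (z * deriv h z)"
proof (rule sums_euler_derivative)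
  show "(h has_field_derivative deriv h z) (at z)"
    by (rule holomorphic_derivI[OF power_series_holomorphic_disk[OF h] _ z]) auto
qed (use h z in auto)

text \<open>For \<open>n \<ge> 2\<close> both weights are nonnegative, so the worst case takes both coefficients maximal.\<close>
lemma coefficient_weight_le_majorant:
  assumes \<alpha>: "0 \<le> \<alpha>" "\<alpha> < 1" and n: "2 \<le> n"
    and a: "a \<le> (2 * real n + 1) * (real n + 1) / 6" and b: "b \<le> (2 * real n - 1) * (real n - 1) / 6"
  shows "real n * ((real n - \<alpha>) * a + (real n + \<alpha>) * b) \<le> majorant_coeff \<alpha> n"
proof -
  have "real n * ((real n - \<alpha>) * a + (real n + \<alpha>) * b) \<le>
    real n * ((real n - \<alpha>) * ((2 * real n + 1) * (real n + 1) / 6)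
      + (real n + \<alpha>) * ((2 * real n - 1) * (real n - 1) / 6))"
    using \<alpha> n by (intro mult_left_mono add_mono a b) auto
  also have "\<dots> = majorant_coeff \<alpha> n"
    by (simp add: majorant_coeff_def field_simps power2_eq_square power4_eq_xxxx)
  finally show ?thesis .
qed

text \<open>Applying \<open>D_op\<close> multiplies coefficients by \<open>n\<close>, and dilating by \<open>r\<close> multiplies them by
  \<open>r ^ (n - 1)\<close>. The weighted sum in the coefficient criterion is therefore at most
  \<open>majorant \<alpha> r - (1 - \<alpha>)\<close>, and \<open>0 \<le> p_poly \<alpha> r\<close> bounds this by \<open>1 - \<alpha>\<close>.\<close>
lemma dilated_D_op_starlike:
  assumes \<alpha>: "0 \<le> \<alpha>" "\<alpha> < 1" and \<epsilon>: "cmod \<epsilon> = 1"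
    and r: "0 < r" "r < 1" "0 \<le> p_poly \<alpha> r" and f: "f \<in> admissible"
  shows "fully_starlike_of_order \<alpha> (dilate r (D_op \<epsilon> f))"
proof -
  obtain h g a b where fhg: "\<And>z. z \<in> \<bbbD> \<Longrightarrow> f z = h z + cnj (g z)"
    and h: "\<And>z. z \<in> \<bbbD> \<Longrightarrow> (\<lambda>n. a n * z ^ n) sums h z" and a01: "a 0 = 0" "a 1 = 1"
    and g: "\<And>z. z \<in> \<bbbD> \<Longrightarrow> (\<lambda>n. b n * z ^ n) sums g z" and b01: "b 0 = 0" "b 1 = 0"
    and ab: "\<And>n. n \<ge> 2 \<Longrightarrow> cmod (a n) \<le> (2 * real n + 1) * (real n + 1) / 6 \<and>
             cmod (b n) \<le> (2 * real n - 1) * (real n - 1) / 6"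
    using f unfolding admissible_def by blast
  define A where "A = (\<lambda>n. if n < 2 then 0 else of_nat n * a n * of_real r ^ (n - 1))"
  define B where "B = (\<lambda>n. if n < 2 then 0 else - cnj \<epsilon> * (of_nat n * b n * of_real r ^ (n - 1)))"
  show ?thesis
  proof (rule fully_starlike_coefficient_criterion[OF \<alpha>])
    show "n < 2 \<Longrightarrow> A n = 0 \<and> B n = 0" for n by (simp add: A_def B_def)
    fix z assume z: "z \<in> \<bbbD>"
    define w where "w = of_real r * z"
    have w: "w \<in> \<bbbD>" using z r mult_strict_mono[of r 1 "cmod z" 1] by (simp add: w_def norm_mult)
    have wn: "w ^ n / of_real r = of_real r ^ (n - 1) * z ^ n" if "n > 0" for n
      using that r by (cases n) (auto simp: w_def power_mult_distrib)
    have "(\<lambda>n. of_nat n * a n * w ^ n / of_real r - (if n = 1 then z else 0))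
        sums (w * deriv h w / of_real r - z)"
      by (intro sums_diff sums_divide sums_euler_disk[OF h w] sums_single)
    moreover have "of_nat n * a n * w ^ n / of_real r - (if n = 1 then z else 0) = A n * z ^ n" for n
    proof -
      consider "n = 0" | "n = 1" | "n \<ge> 2" by linarith
      then show ?thesis
      proof cases
        case 3
        then have "of_nat n * a n * w ^ n / of_real r = of_nat n * a n * (of_real r ^ (n - 1) * z ^ n)"
          using wn[of n] by (metis times_divide_eq_right not_gr0 not_numeral_le_zero)
        with 3 show ?thesis by (simp add: A_def mult.assoc)
      qed (use r a01 in \<open>auto simp: A_def w_def\<close>)
    qed
    ultimately have As: "(\<lambda>n. A n * z ^ n) sums (w * deriv h w / of_real r - z)" by simp
    have "(\<lambda>n. - cnj \<epsilon> * (of_nat n * b n * w ^ n / of_real r))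
        sums (- cnj \<epsilon> * (w * deriv g w / of_real r))"
      by (intro sums_mult sums_divide sums_euler_disk[OF g w])
    moreover have "- cnj \<epsilon> * (of_nat n * b n * w ^ n / of_real r) = B n * z ^ n" for n
    proof -
      consider "n = 0" | "n = 1" | "n \<ge> 2" by linarith
      then show ?thesis
      proof cases
        case 3
        then have "of_nat n * b n * w ^ n / of_real r = of_nat n * b n * (of_real r ^ (n - 1) * z ^ n)"
          using wn[of n] by (metis times_divide_eq_right not_gr0 not_numeral_le_zero)
        with 3 show ?thesis by (simp add: B_def mult.assoc)
      qed (use r b01 in \<open>auto simp: B_def w_def\<close>)
    qed
    ultimately have Bs: "(\<lambda>n. B n * z ^ n) sums (- cnj \<epsilon> * (w * deriv g w / of_real r))" by simp
    have "h holomorphic_on \<bbbD>" by (rule power_series_holomorphic_disk[OF h])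
    moreover have "g holomorphic_on \<bbbD>" by (rule power_series_holomorphic_disk[OF g])
    moreover note fhg w
    ultimately have "D_op \<epsilon> f w = w * deriv h w - \<epsilon> * cnj (w * deriv g w)"
      by (rule D_op_harmonic)
    then have "dilate r (D_op \<epsilon> f) z = (w * deriv h w - \<epsilon> * cnj (w * deriv g w)) / of_real r"
      by (simp add: dilate_def w_def)
    also have "\<dots> = z + (w * deriv h w / of_real r - z) + cnj (- cnj \<epsilon> * (w * deriv g w / of_real r))"
      by (simp add: diff_divide_distrib)
    finally show "dilate r (D_op \<epsilon> f) z = z + (\<Sum>n. A n * z ^ n) + cnj (\<Sum>n. B n * z ^ n)"
      using As Bs by (simp add: sums_iff)
  next
    define W where "W = (\<lambda>n. (real n - \<alpha>) * cmod (A n) + (real n + \<alpha>) * cmod (B n))"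
    define M where "M = (\<lambda>n. majorant_coeff \<alpha> n * r ^ n / r - (if n = 1 then 1 - \<alpha> else 0))"
    have M: "M sums (r * majorant \<alpha> r / r - (1 - \<alpha>))"
      unfolding M_def using r by (intro sums_diff sums_divide majorant_sums sums_single) auto
    have W0: "0 \<le> W n" for n
      by (cases "n < 2") (use \<alpha> in \<open>auto simp: W_def A_def B_def intro!: add_nonneg_nonneg mult_nonneg_nonneg\<close>)
    have WM: "W n \<le> M n" for n
    proof -
      consider "n = 0" | "n = 1" | "n \<ge> 2" by linarith
      then show ?thesis
      proof cases
        case 3
        have rn: "r ^ n / r = r ^ (n - 1)" using 3 r by (cases n) auto
        have "W n = real n * ((real n - \<alpha>) * cmod (a n) + (real n + \<alpha>) * cmod (b n)) * r ^ (n - 1)"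
          using 3 r \<epsilon> by (simp add: W_def A_def B_def norm_mult norm_power algebra_simps)
        also have "\<dots> \<le> majorant_coeff \<alpha> n * r ^ (n - 1)"
          using coefficient_weight_le_majorant[OF \<alpha> 3] ab[OF 3] r by (intro mult_right_mono) auto
        also have "\<dots> = M n" 
          unfolding M_def times_divide_eq_right[symmetric] rn using 3 by simp
        finally show ?thesis .
      qed (use r in \<open>auto simp: W_def A_def B_def M_def majorant_coeff_def\<close>)
    qed
    have smW: "summable W"
      by (rule summable_comparison_test'[OF sums_summable[OF M], of 0]) (use W0 WM in auto)
    then show "summable (\<lambda>n. (real n - \<alpha>) * cmod (A n) + (real n + \<alpha>) * cmod (B n))"
      by (simp add: W_def)
    have "suminf W \<le> suminf M" by (intro suminf_le WM smW sums_summable[OF M])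
    also have "\<dots> = majorant \<alpha> r - (1 - \<alpha>)" using M r by (simp add: sums_iff)
    also have "\<dots> \<le> 1 - \<alpha>"
      using r p_poly_eq_majorant[of r \<alpha>] by (simp add: zero_le_mult_iff)
    finally show "(\<Sum>n. (real n - \<alpha>) * cmod (A n) + (real n + \<alpha>) * cmod (B n)) \<le> 1 - \<alpha>"
      by (simp add: W_def)
  qed
qed

text \<open>All coefficients have maximal modulus. Their phases (negative \<open>a n\<close>, and \<open>b n\<close> opposite to
  \<open>\<epsilon>\<close>) make every term of the angular derivative of \<open>D_op \<epsilon> f\<close> from \<open>n = 2\<close> on negative at a
  positive real point, so that all triangle inequalities of the criterion become equalities there.
  The last two conclusions evaluate \<open>D_op \<epsilon> f\<close> and its angular derivative divided by \<open>\<i>\<close>.\<close>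
lemma extremal_admissible:
  fixes \<epsilon> :: complex
  assumes \<epsilon>: "cmod \<epsilon> = 1"
  obtains f H G where "f \<in> admissible"
    "H holomorphic_on \<bbbD>" "G holomorphic_on \<bbbD>"
    "\<And>z. z \<in> \<bbbD> \<Longrightarrow> D_op \<epsilon> f z = H z + cnj (G z)"
    "\<And>x. 0 \<le> x \<Longrightarrow> x < 1 \<Longrightarrow> H (of_real x) + cnj (G (of_real x)) = of_real (2 * x - x * (1 + x) / (1 - x) ^ 3)"
    "\<And>x. 0 \<le> x \<Longrightarrow> x < 1 \<Longrightarrow> of_real x * deriv H (of_real x) - cnj (of_real x * deriv G (of_real x))
       = of_real (2 * x - x * majorant 0 x)"
proof -
  define s where "s = (\<lambda>n::nat. (2 * real n + 1) * (real n + 1) / 6)"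
  define t where "t = (\<lambda>n::nat. (2 * real n - 1) * (real n - 1) / 6)"
  \<comment> \<open>Since \<open>s 1 = 1\<close>, the summand \<open>2\<close> turns the coefficient \<open>- s 1\<close> into the normalization \<open>1\<close>,
    and the closed forms for the full series can be used from \<open>n = 1\<close> on.\<close>
  define a where "a = (\<lambda>n. if n = 0 then 0 else of_real ((if n = 1 then 2 else 0) - s n) :: complex)"
  define b where "b = (\<lambda>n. if n = 0 then 0 else - \<epsilon> * of_real (t n))"
  define h where "h = (\<lambda>z. \<Sum>n. a n * z ^ n)"
  define g where "g = (\<lambda>z. \<Sum>n. b n * z ^ n)"
  define f where "f = (\<lambda>z. h z + cnj (g z))"
  have st: "\<bar>s n\<bar> \<le> real n ^ 2" "\<bar>t n\<bar> \<le> real n ^ 2" if "n \<ge> 1" for n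
  proof -
    have "0 \<le> (real n - 1) * (4 * real n + 1)" "0 \<le> (real n + 1) * (4 * real n - 1)"
      using that by (auto intro!: mult_nonneg_nonneg)
    moreover have "s n \<ge> 0" "t n \<ge> 0" using that by (auto simp: s_def t_def)
    ultimately show "\<bar>s n\<bar> \<le> real n ^ 2" "\<bar>t n\<bar> \<le> real n ^ 2"
      by (simp_all add: s_def t_def power2_eq_square algebra_simps)
  qed
  have an: "cmod (a n) \<le> real n ^ 2" for n
  proof -
    consider "n = 0" | "n = 1" | "n \<ge> 2" by linarith
    then show ?thesis
      by cases (use st[of n] in \<open>auto simp: a_def s_def simp del: of_real_diff of_real_minus\<close>)
  qed
  have bn: "cmod (b n) \<le> real n ^ 2" for n
    using st[of n] \<epsilon> by (auto simp: b_def norm_mult)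
  have sm: "summable (\<lambda>n. c n * z ^ n)" if "\<And>n. cmod (c n) \<le> real n ^ 2" "z \<in> \<bbbD>" for c :: "nat \<Rightarrow> complex" and z
  proof -
    have "summable (\<lambda>n. real n ^ 2 * cmod z ^ n)"
      using sums_second_and_fourth_powers(1)[of "cmod z"] that by (auto simp: sums_iff)
    then have "summable (\<lambda>n. norm (c n * z ^ n))"
      by (rule summable_comparison_test'[where N = 0])
        (use that in \<open>auto simp: norm_mult norm_power intro!: mult_right_mono\<close>)
    then show ?thesis by (rule summable_norm_cancel)
  qed
  have hs: "(\<lambda>n. a n * z ^ n) sums h z" and gs: "(\<lambda>n. b n * z ^ n) sums g z" if "z \<in> \<bbbD>" for z
    using sm[OF an that] sm[OF bn that] by (auto simp: h_def g_def summable_sums)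
  have adm: "f \<in> admissible"
    unfolding admissible_def mem_Collect_eq
  proof (rule exI[of _ h], rule exI[of _ g], rule exI[of _ a], rule exI[of _ b], intro conjI ballI allI impI)
    fix n :: nat assume n: "2 \<le> n"
    then have ca: "cmod (a n) = s n" and cb: "cmod (b n) = t n"
      using \<epsilon> by (auto simp: a_def b_def s_def t_def norm_mult simp del: of_real_mult of_real_divide of_real_add of_real_diff)
    show "cmod (a n) \<le> (2 * real n + 1) * (real n + 1) / 6" "cmod (b n) \<le> (2 * real n - 1) * (real n - 1) / 6"
      by (simp_all add: ca cb s_def t_def)
    have "s n - t n = real n" by (simp add: s_def t_def field_simps)
    then show "\<bar>cmod (a n) - cmod (b n)\<bar> \<le> real n" by (simp add: ca cb)
  qed (use hs gs in \<open>auto simp: f_def a_def b_def s_def t_def\<close>)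
  have hol: "h holomorphic_on \<bbbD>" "g holomorphic_on \<bbbD>"
    by (rule power_series_holomorphic_disk[OF hs], assumption)
       (rule power_series_holomorphic_disk[OF gs])
  define H where "H = (\<lambda>z. z * deriv h z)"
  define G where "G = (\<lambda>z. - cnj \<epsilon> * (z * deriv g z))"
  have D: "D_op \<epsilon> f z = H z + cnj (G z)" if "z \<in> \<bbbD>" for z
    using D_op_harmonic[OF hol _ that, of f \<epsilon>] by (simp add: f_def H_def G_def)
  have Hhol: "H holomorphic_on \<bbbD>" "G holomorphic_on \<bbbD>"
    unfolding H_def G_def by (intro holomorphic_intros hol holomorphic_deriv open_ball)+
  define A where "A = (\<lambda>n. (if n = 1 then 2 else 0) - real n * s n)"
  define B where "B = (\<lambda>n. real n * t n)"
  have "cnj \<epsilon> * \<epsilon> = 1"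
    using \<epsilon> complex_norm_square[of \<epsilon>] by (simp add: mult.commute)
  then have eb: "- cnj \<epsilon> * b n = (if n = 0 then 0 else of_real (t n))" for n
    by (simp add: b_def flip: mult.assoc)
  have Hs: "(\<lambda>n. of_real (A n) * z ^ n) sums H z" if "z \<in> \<bbbD>" for z
  proof -
    have "of_nat n * a n = of_real (A n)" for n by (simp add: a_def A_def)
    then show ?thesis using sums_euler_disk[OF hs that] by (simp add: H_def)
  qed
  have Gs: "(\<lambda>n. of_real (B n) * z ^ n) sums G z" if "z \<in> \<bbbD>" for z
  proof -
    have "- cnj \<epsilon> * (of_nat n * b n * z ^ n) = of_real (B n) * z ^ n" for n
    proof -
      have "- cnj \<epsilon> * (of_nat n * b n * z ^ n) = of_nat n * (- cnj \<epsilon> * b n) * z ^ n" by simp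
      also have "\<dots> = of_real (B n) * z ^ n" unfolding eb by (simp add: B_def)
      finally show ?thesis .
    qed
    then show ?thesis
      using sums_mult[OF sums_euler_disk[OF gs that], of "- cnj \<epsilon>"] by (simp only: G_def)
  qed
  show ?thesis
  proof (rule that[OF adm Hhol D])
    fix x :: real assume x: "0 \<le> x" "x < 1"
    then have xD: "of_real x \<in> \<bbbD>" by simp
    have lin: "(\<lambda>n. if n = 1 then 2 * x else 0) sums (2 * x)" by (rule sums_single)
    have "(\<lambda>n. (if n = 1 then 2 * x else 0) - real n ^ 2 * x ^ n) sums (2 * x - x * (1 + x) / (1 - x) ^ 3)"
      using x by (intro sums_diff lin sums_second_and_fourth_powers) auto
    moreover have "(if n = 1 then 2 * x else 0) - real n ^ 2 * x ^ n = (A n + B n) * x ^ n" for n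
      by (auto simp: A_def B_def s_def t_def field_simps power2_eq_square)
    ultimately have 1: "(\<lambda>n. (A n + B n) * x ^ n) sums (2 * x - x * (1 + x) / (1 - x) ^ 3)" by simp
    have "(\<lambda>n. of_real (A n) * of_real x ^ n + cnj (of_real (B n) * of_real x ^ n))
        sums (H (of_real x) + cnj (G (of_real x)))"
      by (intro sums_add Hs[OF xD] sums_cnj[THEN iffD2] Gs[OF xD])
    then have "(\<lambda>n. of_real ((A n + B n) * x ^ n)) sums (H (of_real x) + cnj (G (of_real x)))"
      by (simp add: distrib_right)
    from sums_unique2[OF this sums_of_real[OF 1]]
    show "H (of_real x) + cnj (G (of_real x)) = of_real (2 * x - x * (1 + x) / (1 - x) ^ 3)" .
    have "(\<lambda>n. (if n = 1 then 2 * x else 0) - majorant_coeff 0 n * x ^ n) sums (2 * x - x * majorant 0 x)"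
      using x by (intro sums_diff lin majorant_sums) auto
    moreover have "(if n = 1 then 2 * x else 0) - majorant_coeff 0 n * x ^ n = real n * (A n - B n) * x ^ n" for n
      by (auto simp: A_def B_def s_def t_def majorant_coeff_def field_simps power2_eq_square power4_eq_xxxx)
    ultimately have 2: "(\<lambda>n. real n * (A n - B n) * x ^ n) sums (2 * x - x * majorant 0 x)" by simp
    have "(\<lambda>n. of_nat n * of_real (A n) * of_real x ^ n - cnj (of_nat n * of_real (B n) * of_real x ^ n))
        sums (of_real x * deriv H (of_real x) - cnj (of_real x * deriv G (of_real x)))"
      by (intro sums_diff sums_euler_disk[OF Hs xD] sums_cnj[THEN iffD2] sums_euler_disk[OF Gs xD])
    then have "(\<lambda>n. of_real (real n * (A n - B n) * x ^ n))
        sums (of_real x * deriv H (of_real x) - cnj (of_real x * deriv G (of_real x)))"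
      by (simp add: algebra_simps)
    from sums_unique2[OF this sums_of_real[OF 2]]
    show "of_real x * deriv H (of_real x) - cnj (of_real x * deriv G (of_real x))
       = of_real (2 * x - x * majorant 0 x)" .
  qed
qed

text \<open>At \<open>\<theta> = 0\<close> and radius \<open>x\<close>, the angular derivative of the argument of the extremal map is
  \<open>(2 - majorant 0 x) / E x\<close>, where \<open>x * E x\<close> is the value of the map. It is less than \<open>\<alpha>\<close> exactly
  when \<open>majorant \<alpha> x > 2 (1 - \<alpha>)\<close>, provided that \<open>E x > 0\<close>. The former holds for every \<open>x > r\<close>; the
  latter holds at \<open>r\<close> and hence slightly beyond. A dilation by \<open>\<rho> > r\<close> contains such a circle.\<close>
lemma starlike_radius_cannot_grow:
  assumes \<alpha>: "0 \<le> \<alpha>" "\<alpha> < 1" and \<epsilon>: "cmod \<epsilon> = 1"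
    and r: "0 < r" "r < 1" "p_poly \<alpha> r = 0" and \<rho>: "r < \<rho>" "\<rho> \<le> 1"
  shows "\<exists>f\<in>admissible. \<not> fully_starlike_of_order \<alpha> (dilate \<rho> (D_op \<epsilon> f))"
proof -
  obtain f H G where f: "f \<in> admissible" and hol: "H holomorphic_on \<bbbD>" "G holomorphic_on \<bbbD>"
    and D: "\<And>z. z \<in> \<bbbD> \<Longrightarrow> D_op \<epsilon> f z = H z + cnj (G z)"
    and val: "\<And>x. 0 \<le> x \<Longrightarrow> x < 1 \<Longrightarrow> H (of_real x) + cnj (G (of_real x)) = of_real (2 * x - x * (1 + x) / (1 - x) ^ 3)"
    and der: "\<And>x. 0 \<le> x \<Longrightarrow> x < 1 \<Longrightarrow> of_real x * deriv H (of_real x) - cnj (of_real x * deriv G (of_real x))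
       = of_real (2 * x - x * majorant 0 x)"
    using extremal_admissible[OF \<epsilon>] by blast
  define E where "E = (\<lambda>x::real. 2 - (1 + x) / (1 - x) ^ 3)"
  have Qr: "majorant \<alpha> r = 2 * (1 - \<alpha>)" using r p_poly_eq_majorant[of r \<alpha>] by simp
  have "(1 - \<alpha>) * E r = 8 * r * (1 + r) / (1 - r) ^ 5"
    using Qr by (simp add: E_def majorant_def right_diff_distrib)
  also have "\<dots> > 0" using r by simp
  finally have Er: "E r > 0" using \<alpha> by (simp add: zero_less_mult_iff)
  have "isCont E r" unfolding E_def using r by (intro continuous_intros) auto
  then have "\<exists>\<delta>>0. \<forall>x. dist x r < \<delta> \<longrightarrow> dist (E x) (E r) < E r"
    using Er unfolding continuous_at_eps_delta by blast
  then obtain \<delta> where d: "\<delta> > 0" "\<And>x. dist x r < \<delta> \<Longrightarrow> dist (E x) (E r) < E r"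
    by blast
  have \<delta>: "\<delta> > 0" "\<And>x. \<bar>x - r\<bar> < \<delta> \<Longrightarrow> E x > 0"
    using d unfolding dist_real_def by (auto simp: abs_less_iff)
  define x where "x = min (r + \<delta> / 2) ((r + \<rho>) / 2)"
  have x: "r < x" "x < \<rho>" "x < 1" "E x > 0"
    using \<delta>(1) \<rho> by (auto simp: x_def min_def intro!: \<delta>(2))
  have x0: "0 < x" using x r by simp
  define t where "t = x / \<rho>"
  have t: "t \<in> {0<..<1}" "\<rho> * t = x" using x x0 by (auto simp: t_def)
  have "\<not> fully_starlike_of_order \<alpha> (dilate \<rho> (D_op \<epsilon> f))"
  proof
    assume "fully_starlike_of_order \<alpha> (dilate \<rho> (D_op \<epsilon> f))"
    then obtain \<phi> where br: "\<And>\<theta>. dilate \<rho> (D_op \<epsilon> f) (of_real t * cis \<theta>)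
        = of_real (cmod (dilate \<rho> (D_op \<epsilon> f) (of_real t * cis \<theta>))) * cis (\<phi> \<theta>)"
      and "\<forall>\<theta>\<in>{0..<2*pi}. \<exists>d. (\<phi> has_real_derivative d) (at \<theta>) \<and> d > \<alpha>"
      unfolding fully_starlike_of_order_def using t(1) by blast
    then obtain d where d: "(\<phi> has_real_derivative d) (at 0)" "d > \<alpha>" by force
    define P where "P = (\<lambda>\<theta>. H (of_real x * cis \<theta>) + cnj (G (of_real x * cis \<theta>)))"
    have dil: "dilate \<rho> (D_op \<epsilon> f) (of_real t * cis \<theta>) = P \<theta> / of_real \<rho>" for \<theta>
    proof -
      have "of_real \<rho> * (of_real t * cis \<theta>) = of_real x * cis \<theta>" using t(2) by (metis mult.assoc of_real_mult)
      moreover have "of_real x * cis \<theta> \<in> \<bbbD>" using x x0 by (simp add: norm_mult)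
      ultimately show ?thesis by (simp only: dilate_def P_def D)
    qed
    have branch: "P \<theta> = of_real (cmod (P \<theta>)) * cis (\<phi> \<theta>)" for \<theta>
      using br[of \<theta>] x x0 unfolding dil by (simp add: norm_divide)
    have xD: "of_real x * cis 0 \<in> \<bbbD>" using x x0 by simp
    have "(P has_vector_derivative
      \<i> * (of_real x * cis 0 * deriv H (of_real x * cis 0) - cnj (of_real x * cis 0 * deriv G (of_real x * cis 0)))) (at 0)"
      unfolding P_def
      by (intro harmonic_circle_derivative holomorphic_derivI[OF hol(1) open_ball xD] holomorphic_derivI[OF hol(2) open_ball xD])
    then have P': "(P has_vector_derivative \<i> * of_real (2 * x - x * majorant 0 x)) (at 0)"
      using der[of x] x x0 by simp
    have P0: "P 0 = of_real (x * E x)"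
      using val[of x] x x0 by (simp add: P_def E_def algebra_simps)
    have "P 0 \<noteq> 0" using P0 x x0 by simp
    from argument_branch_derivative[OF P' this d(1) branch]
    have "d = (2 * x - x * majorant 0 x) / (x * E x)"
      unfolding P0 by (simp flip: of_real_divide times_divide_eq_right del: of_real_mult of_real_diff)
    also have "\<dots> = x * (2 - majorant 0 x) / (x * E x)" by (simp add: algebra_simps)
    also have "\<dots> = (2 - majorant 0 x) / E x" using x0 by simp
    also have "\<dots> < \<alpha>"
    proof -
      have "2 * (1 - \<alpha>) < majorant \<alpha> x"
        using majorant_strict_mono[OF \<alpha>(2), of r x] Qr r x by simp
      also have "majorant \<alpha> x = majorant 0 x - \<alpha> * (2 - E x)"
        by (simp add: majorant_def E_def left_diff_distrib diff_divide_distrib)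
      finally have "2 - majorant 0 x < \<alpha> * E x" by (simp add: algebra_simps)
      then show ?thesis using x by (simp add: pos_divide_less_eq)
    qed
    finally show False using d(2) by simp
  qed
  with f show ?thesis by blast
qed

lemma starlike_radius:
  assumes \<alpha>: "0 \<le> \<alpha>" "\<alpha> < 1" and \<epsilon>: "cmod \<epsilon> = 1"
    and r: "0 < r" "r < 1" "p_poly \<alpha> r = 0"
  shows "is_sharp_radius (fully_starlike_of_order \<alpha>) (D_op \<epsilon> ` admissible) r"
  unfolding is_sharp_radius_def
  using r dilated_D_op_starlike[OF \<alpha> \<epsilon> r(1,2)] starlike_radius_cannot_grow[OF \<alpha> \<epsilon> r] by auto

theorem theorem2p2:
  fixes \<alpha> :: real and \<epsilon> :: complex
  assumes "0 \<le> \<alpha>" "\<alpha> < 1" "cmod \<epsilon> = 1"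
  shows "(\<exists>r\<^sub>s. {r \<in> {0<..<1}. p_poly \<alpha> r = 0} = {r\<^sub>s} \<and>
            is_sharp_radius (fully_starlike_of_order \<alpha>) (D_op \<epsilon> ` admissible) r\<^sub>s) \<and>
         (\<exists>r\<^sub>u. {r \<in> {0<..<1}. 1 - 17 * r + 13 * r^2 - 21 * r^3 + 10 * r^4 - 2 * r^5 = 0} = {r\<^sub>u} \<and>
            \<bar>r\<^sub>u - 0.0614313\<bar> < 5 / 10^8 \<and>
            is_sharp_radius fully_starlike (D_op \<epsilon> ` admissible) r\<^sub>u)"
proof (rule conjI)
  have root_set: "{x \<in> {0<..<1}. p_poly \<beta> x = 0} = {r}"
    if "0 < r" "r < 1" "p_poly \<beta> r = 0"
      "\<And>x. 0 \<le> x \<Longrightarrow> x < r \<Longrightarrow> 0 < p_poly \<beta> x" "\<And>x. r < x \<Longrightarrow> x < 1 \<Longrightarrow> p_poly \<beta> x < 0" for \<beta> r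
    using that by (auto, metis less_irrefl linorder_neqE_linordered_idom less_imp_le)
  obtain r where r: "0 < r" "r < 1" "p_poly \<alpha> r = 0"
    and rs: "\<And>x. 0 \<le> x \<Longrightarrow> x < r \<Longrightarrow> 0 < p_poly \<alpha> x" "\<And>x. r < x \<Longrightarrow> x < 1 \<Longrightarrow> p_poly \<alpha> x < 0"
    using p_poly_unique_sign_change[OF assms(2)] by blast
  show "\<exists>r\<^sub>s. {r \<in> {0<..<1}. p_poly \<alpha> r = 0} = {r\<^sub>s} \<and>
            is_sharp_radius (fully_starlike_of_order \<alpha>) (D_op \<epsilon> ` admissible) r\<^sub>s"
    using root_set[OF r rs] starlike_radius[OF assms r] by blast
  obtain u where u: "0 < u" "u < 1" "p_poly 0 u = 0"
    and us: "\<And>x. 0 \<le> x \<Longrightarrow> x < u \<Longrightarrow> 0 < p_poly 0 x" "\<And>x. u < x \<Longrightarrow> x < 1 \<Longrightarrow> p_poly 0 x < 0"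
    using p_poly_unique_sign_change[of 0] by auto
  have p0: "p_poly 0 x = 1 - 17 * x + 13 * x^2 - 21 * x^3 + 10 * x^4 - 2 * x^5" for x
    by (simp add: p_poly_def)
  \<comment> \<open>The two ends of the interval of radius \<open>5 / 10^8\<close> around \<open>0.0614313\<close>.\<close>
  have num: "0 < p_poly 0 0.06143125" "p_poly 0 0.06143135 < 0"
    unfolding p0 by (simp_all add: power_divide)
  have lo: "x < u" if "0 < p_poly 0 x" "x < 1" for x
    using us(2)[of x] u(3) that by (cases x u rule: linorder_cases) auto
  have hi: "u < x" if "p_poly 0 x < 0" "0 \<le> x" for x
    using us(1)[of x] u(3) that by (cases x u rule: linorder_cases) auto
  have "0.06143125 < u" by (rule lo[OF num(1)]) simp
  moreover have "u < 0.06143135" by (rule hi[OF num(2)]) simp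
  ultimately have "\<bar>u - 0.0614313\<bar> < 5 / 10^8" unfolding abs_less_iff by simp
  then show "\<exists>r\<^sub>u. {r \<in> {0<..<1}. 1 - 17 * r + 13 * r^2 - 21 * r^3 + 10 * r^4 - 2 * r^5 = 0} = {r\<^sub>u} \<and>
            \<bar>r\<^sub>u - 0.0614313\<bar> < 5 / 10^8 \<and>
            is_sharp_radius fully_starlike (D_op \<epsilon> ` admissible) r\<^sub>u"
    using root_set[OF u us] starlike_radius[OF order_refl zero_less_one assms(3) u]
    unfolding p0 fully_starlike_def by blast
qed

end
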